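(* Let $0<\beta<1$ and $q=1/(1-\beta)$. There is a sequence $\{f_j\}_{j\ge1}\subset BV(\mathbb{Z})$ and a function $f\in BV(\mathbb{Z})$ such that $\|f_j-f\|_{BV(\mathbb{Z})}\to0$ as $j\to\infty$ but $\mathrm{Var}_q\big(\mathcal{M}_\beta f_j-\mathcal{M}_\beta f\big)\not\to0$ as $j\to\infty$.
   Context: For $g:\mathbb{Z}\to\mathbb{R}$, the total variation is $\mathrm{Var}(g)=\sum_{n\in\mathbb{Z}}|g(n+1)-g(n)|$, and for $1\le q<\infty$ the $q$-variation (with values in $[0,\infty]$) is $\mathrm{Var}_q(g)=\big(\sum_{n\in\mathbb{Z}}|g(n+1)-g(n)|^q\big)^{1/q}$. $BV(\mathbb{Z})$ is the space of functions $f:\mathbb{Z}\to\mathbb{R}$ with $\mathrm{Var}(f)<\infty$, with norm $\|f\|_{BV(\mathbb{Z})}=|f(-\infty)|+\mathrm{Var}(f)$, where $f(-\infty)=\lim_{n\to-\infty}f(n)$. The discrete centered fractional maximal operator is $$\mathcal{M}_\beta f(n)=\sup_{r\in\mathbb{Z},\;r\ge0}\frac{1}{(2r+1)^{1-\beta}}\sum_{k=-r}^{r}|f(n+k)|.$$ The existence of $\mathrm{Var}_q(\mathcal{M}_\beta f_j-\mathcal{M}_\beta f)$ includes that $\mathcal{M}_\beta f_j$ and $\mathcal{M}_\beta f$ are finite-valued. *)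

theory Defs
  imports "HOL-Analysis.Analysis"
begin

definition Var :: "(int \<Rightarrow> real) \<Rightarrow> ennreal" where
  "Var g = (\<Sum>\<^sub>\<infinity>n. ennreal \<bar>g (n + 1) - g n\<bar>)"

text \<open>
  The library has no real powers on \<^typ>\<open>ennreal\<close>, so the outer power \<open>1/q\<close> is taken on
  the reals when the sum is finite; the \<open>q\<close>-variation is infinite when the sum is.
\<close>
definition Var_q :: "real \<Rightarrow> (int \<Rightarrow> real) \<Rightarrow> ennreal" where
  "Var_q q g =
     (let S = (\<Sum>\<^sub>\<infinity>n. ennreal (\<bar>g (n + 1) - g n\<bar> powr q))
      in if S = \<infinity> then \<infinity> else ennreal (enn2real S powr (1 / q)))"

definition BV :: "(int \<Rightarrow> real) set" where
  "BV = {f. Var f < \<infinity>}"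

text \<open>
  For \<open>f\<close> in \<^const>\<open>BV\<close> the limit at minus infinity exists and the norm is finite; outside
  \<^const>\<open>BV\<close> the value is infinite.
\<close>
definition BV_norm :: "(int \<Rightarrow> real) \<Rightarrow> ennreal" where
  "BV_norm f = ennreal \<bar>Lim at_bot f\<bar> + Var f"

text \<open>
  The supremum is taken in \<^typ>\<open>ennreal\<close> because it can be infinite, e.g. for nonzero constants
  if \<open>\<beta> > 0\<close>.
\<close>
definition frac_max :: "real \<Rightarrow> (int \<Rightarrow> real) \<Rightarrow> int \<Rightarrow> ennreal" where
  "frac_max \<beta> f n =
     (SUP r::nat. ennreal (1 / (2 * real r + 1) powr (1 - \<beta>) *
        (\<Sum>k = - int r..int r. \<bar>f (n + k)\<bar>)))"

end

theory Submission
  imports Defs "HOL-Real_Asymp.Real_Asymp"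
begin

text \<open>
  Let \<open>f\<close> be the indicator function of \<open>{0}\<close>; its maximal function drops from \<open>1\<close> to
  \<open>3 powr (\<beta> - 1)\<close> between \<open>0\<close> and \<open>1\<close>. Put \<open>f\<^sub>j = f + \<epsilon>\<^sub>j 1\<^bsub>[-L\<^sub>j, L\<^sub>j]\<^esub>\<close> with \<open>\<epsilon>\<^sub>j = 1 / j\<close>, so
  that \<open>f\<^sub>j - f\<close> has variation \<open>2\<epsilon>\<^sub>j\<close>, but with \<open>L\<^sub>j\<close> so large that \<open>\<epsilon>\<^sub>j L\<^sub>j powr \<beta>\<close> is huge.
  Then only averages over large radii matter for the maximal function of \<open>f\<^sub>j\<close> near \<open>0\<close>. Such
  averages hardly change when the centre moves by one, so the maximal function of \<open>f\<^sub>j\<close> is almost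
  flat there, and the difference of the maximal functions keeps a jump between \<open>0\<close> and \<open>1\<close>.
\<close>

section \<open>Single averages: elementary bounds\<close>

definition frac_avg :: "real \<Rightarrow> (int \<Rightarrow> real) \<Rightarrow> int \<Rightarrow> nat \<Rightarrow> real" where
  "frac_avg \<beta> f n r =
     1 / (2 * real r + 1) powr (1 - \<beta>) * (\<Sum>k = - int r..int r. \<bar>f (n + k)\<bar>)"

lemma frac_max_eq_SUP_frac_avg: "frac_max \<beta> f n = (SUP r. ennreal (frac_avg \<beta> f n r))"
  by (simp add: frac_max_def frac_avg_def)

lemma frac_avg_nonneg: "0 \<le> frac_avg \<beta> f n r"
  by (simp add: frac_avg_def sum_nonneg)

lemma frac_max_le:
  assumes "\<And>r. frac_avg \<beta> f n r \<le> C"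
  shows "frac_max \<beta> f n \<le> ennreal C"
  unfolding frac_max_eq_SUP_frac_avg by (intro SUP_least ennreal_leI assms)

lemma enn2real_frac_max_le:
  assumes "\<And>r. frac_avg \<beta> f n r \<le> C"
  shows "enn2real (frac_max \<beta> f n) \<le> C"
proof -
  have "0 \<le> C"
    using frac_avg_nonneg[of \<beta> f n 0] assms[of 0] by linarith
  with frac_max_le[OF assms] show ?thesis
    by (rule enn2real_leI[rotated])
qed

text \<open>Finiteness is essential, since \<open>enn2real\<close> sends \<open>\<infinity>\<close>
  to 0.\<close>

lemma frac_avg_le_enn2real_frac_max:
  assumes "frac_max \<beta> f n < \<infinity>"
  shows "frac_avg \<beta> f n r \<le> enn2real (frac_max \<beta> f n)"
proof -
  have "ennreal (frac_avg \<beta> f n r) \<le> frac_max \<beta> f n"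
    unfolding frac_max_eq_SUP_frac_avg by (rule SUP_upper) simp
  then have "enn2real (ennreal (frac_avg \<beta> f n r)) \<le> enn2real (frac_max \<beta> f n)"
    using assms by (intro enn2real_mono) auto
  then show ?thesis
    by (simp add: frac_avg_nonneg)
qed

lemma window_sum_eq: "(\<Sum>k = - int r..int r. g (n + k)) = (\<Sum>m = n - int r..n + int r. g m)"
  for g :: "int \<Rightarrow> real"
  by (rule sum.reindex_bij_witness[where i="\<lambda>m. m - n" and j="\<lambda>k. n + k"]) auto

text \<open>In this form the windows are intervals around \<open>n\<close>, so windows with
  different centres can be compared by inclusion.\<close>

lemma frac_avg_eq:
  "frac_avg \<beta> f n r =
     1 / (2 * real r + 1) powr (1 - \<beta>) * (\<Sum>m = n - int r..n + int r. \<bar>f m\<bar>)"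
  unfolding frac_avg_def by (subst window_sum_eq[of "\<lambda>m. \<bar>f m\<bar>"]) simp

lemma window_sum_le:
  assumes "\<And>m. \<bar>f m\<bar> \<le> B"
  shows "(\<Sum>m = n - int r..n + int r. \<bar>f m\<bar>) \<le> B * (2 * real r + 1)"
proof -
  have "(\<Sum>m = n - int r..n + int r. \<bar>f m\<bar>) \<le> real (card {n - int r..n + int r}) * B"
    by (rule sum_bounded_above) (use assms in auto)
  then show ?thesis
    by (simp add: algebra_simps)
qed

text \<open>The normalising factor is at most 1, and a window sum never exceeds the total
  mass.\<close>

lemma frac_avg_le_of_support:
  assumes "\<beta> < 1" and "\<And>m. m \<notin> {a..b} \<Longrightarrow> f m = 0"
  shows "frac_avg \<beta> f n r \<le> (\<Sum>m=a..b. \<bar>f m\<bar>)"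
proof -
  have "(\<Sum>m = n - int r..n + int r. \<bar>f m\<bar>) =
      (\<Sum>m \<in> {n - int r..n + int r} \<inter> {a..b}. \<bar>f m\<bar>)"
    by (rule sum.mono_neutral_right) (use assms(2) in auto)
  also have "\<dots> \<le> (\<Sum>m=a..b. \<bar>f m\<bar>)"
    by (rule sum_mono2) auto
  finally have le: "(\<Sum>m = n - int r..n + int r. \<bar>f m\<bar>) \<le> (\<Sum>m=a..b. \<bar>f m\<bar>)" .
  have "1 / (2 * real r + 1) powr (1 - \<beta>) \<le> 1"
    using assms(1) by (simp add: ge_one_powr_ge_zero)
  then have "frac_avg \<beta> f n r \<le> 1 * (\<Sum>m = n - int r..n + int r. \<bar>f m\<bar>)"
    unfolding frac_avg_eq by (intro mult_right_mono sum_nonneg) auto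
  with le show ?thesis
    by simp
qed

lemma frac_max_finite_of_support:
  assumes "\<beta> < 1" and "\<And>m. m \<notin> {a..b} \<Longrightarrow> f m = 0"
  shows "frac_max \<beta> f n < \<infinity>"
proof -
  have "frac_max \<beta> f n \<le> ennreal (\<Sum>m=a..b. \<bar>f m\<bar>)"
    by (rule frac_max_le) (rule frac_avg_le_of_support[OF assms])
  then show ?thesis
    by (rule le_less_trans) simp
qed

text \<open>Used to show that averages over small radii cannot exceed a large value of the maximal
  function.\<close>

lemma frac_avg_le_bound:
  assumes "\<And>m. \<bar>f m\<bar> \<le> B"
  shows "frac_avg \<beta> f n r \<le> B * (2 * real r + 1) powr \<beta>"
proof -
  have "frac_avg \<beta> f n r \<le> 1 / (2 * real r + 1) powr (1 - \<beta>) * (B * (2 * real r + 1))"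
    unfolding frac_avg_eq by (intro mult_left_mono window_sum_le assms) auto
  also have "\<dots> = B * (2 * real r + 1) powr \<beta>"
    by (simp add: powr_diff)
  finally show ?thesis .
qed

text \<open>Even a low plateau of height \<open>c > 0\<close> yields large averages once the window
  inside it is long enough.\<close>

lemma frac_avg_ge_of_const_le:
  assumes "\<And>m. m \<in> {n - int r..n + int r} \<Longrightarrow> c \<le> \<bar>f m\<bar>"
  shows "c * (2 * real r + 1) powr \<beta> \<le> frac_avg \<beta> f n r"
proof -
  have "real (card {n - int r..n + int r}) * c \<le> (\<Sum>m = n - int r..n + int r. \<bar>f m\<bar>)"
    by (rule sum_bounded_below) (use assms in auto)
  then have "1 / (2 * real r + 1) powr (1 - \<beta>) * (c * (2 * real r + 1)) \<le> frac_avg \<beta> f n r"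
    unfolding frac_avg_eq by (intro mult_left_mono) (auto simp: algebra_simps)
  then show ?thesis
    by (simp add: powr_diff mult.commute)
qed

section \<open>Moving the centre by one\<close>

lemma powr_shift_diff_le:
  fixes x s :: real
  assumes "0 < x" "0 \<le> s" "s \<le> 1"
  shows "(1 / x powr s - 1 / (x + 2) powr s) * x \<le> 2 * x powr (- s)"
proof -
  let ?t = "x / (x + 2)"
  \<comment> \<open>Since \<open>?t\<close> lies between 0 and 1 and \<open>s \<le> 1\<close>, the
    power \<open>s\<close> only increases it.\<close>
  have t: "?t \<le> ?t powr s"
    using powr_mono'[of s 1 ?t] assms by simp
  have "1 / (x + 2) powr s = x powr (- s) * ?t powr s"
    using assms by (simp add: powr_divide powr_minus field_simps)
  then have "1 / x powr s - 1 / (x + 2) powr s = x powr (- s) * (1 - ?t powr s)"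
    by (simp add: powr_minus_divide algebra_simps)
  also have "\<dots> \<le> x powr (- s) * (1 - ?t)"
    using t by (intro mult_left_mono) auto
  also have "1 - ?t = 2 / (x + 2)"
    using assms by (simp add: field_simps)
  finally have "(1 / x powr s - 1 / (x + 2) powr s) * x \<le> x powr (- s) * (2 / (x + 2)) * x"
    using assms by (intro mult_right_mono) auto
  also have "\<dots> = x powr (- s) * (2 * x / (x + 2))"
    by simp
  also have "\<dots> \<le> x powr (- s) * 2"
    using assms by (intro mult_left_mono) (auto simp: field_simps)
  finally show ?thesis
    by simp
qed

text \<open>The window of radius \<open>r\<close> around \<open>n\<close> lies in the one of radius
  \<open>Suc r\<close> around \<open>n'\<close>, so the only loss comes from the normalising factor;
  \<open>powr_shift_diff_le\<close> bounds it, with \<open>x\<close> the window length and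
  \<open>s = 1 - \<beta>\<close>.\<close>

lemma frac_avg_shift_le:
  assumes "0 \<le> \<beta>" "\<beta> \<le> 1" and "\<And>m. \<bar>f m\<bar> \<le> B" and "\<bar>n - n'\<bar> \<le> 1"
  shows "frac_avg \<beta> f n r \<le> frac_avg \<beta> f n' (Suc r) + 2 * B * (2 * real r + 1) powr (\<beta> - 1)"
proof -
  define x where "x = 2 * real r + 1"
  define S where "S = (\<Sum>m = n - int r..n + int r. \<bar>f m\<bar>)"
  have x: "0 < x" "2 * real (Suc r) + 1 = x + 2"
    by (auto simp: x_def)
  have "0 \<le> B"
    using assms(3)[of 0] by linarith
  have "S \<le> (\<Sum>m = n' - int (Suc r)..n' + int (Suc r). \<bar>f m\<bar>)"
    unfolding S_def using assms(4) by (intro sum_mono2) auto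
  then have A: "1 / (x + 2) powr (1 - \<beta>) * S \<le> frac_avg \<beta> f n' (Suc r)"
    unfolding frac_avg_eq x(2) by (intro mult_left_mono) auto
  have "(x + 2) powr (1 - \<beta>) \<ge> x powr (1 - \<beta>)"
    using x assms by (intro powr_mono2) auto
  then have "0 \<le> 1 / x powr (1 - \<beta>) - 1 / (x + 2) powr (1 - \<beta>)"
    using x by (simp add: frac_le)
  moreover have "S \<le> B * x"
    unfolding S_def x_def by (rule window_sum_le) (rule assms(3))
  ultimately have "(1 / x powr (1 - \<beta>) - 1 / (x + 2) powr (1 - \<beta>)) * S
      \<le> (1 / x powr (1 - \<beta>) - 1 / (x + 2) powr (1 - \<beta>)) * (B * x)"
    by (rule mult_left_mono[rotated])
  also have "\<dots> = B * ((1 / x powr (1 - \<beta>) - 1 / (x + 2) powr (1 - \<beta>)) * x)"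
    by simp
  also have "\<dots> \<le> B * (2 * x powr (- (1 - \<beta>)))"
    using assms x \<open>0 \<le> B\<close> by (intro mult_left_mono powr_shift_diff_le) auto
  finally have "1 / x powr (1 - \<beta>) * S
      \<le> 1 / (x + 2) powr (1 - \<beta>) * S + 2 * B * x powr (\<beta> - 1)"
    by (simp add: algebra_simps)
  moreover have "frac_avg \<beta> f n r = 1 / x powr (1 - \<beta>) * S"
    by (simp add: frac_avg_eq x_def S_def)
  ultimately show ?thesis
    using A unfolding x_def by linarith
qed

text \<open>Radii are split at \<open>R\<close>: up to \<open>R\<close>, \<open>large\<close>
  already bounds the averages by the maximal function at \<open>n'\<close>; beyond \<open>R\<close>,
  moving the centre costs at most \<open>\<delta>\<close> by \<open>small\<close>.\<close>

lemma frac_max_shift_le: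
  assumes "0 \<le> \<beta>" "\<beta> \<le> 1" and B: "\<And>m. \<bar>f m\<bar> \<le> B" and "\<bar>n - n'\<bar> \<le> 1"
    and fin: "frac_max \<beta> f n' < \<infinity>"
    and large: "B * (2 * real R + 1) powr \<beta> \<le> enn2real (frac_max \<beta> f n')"
    and small: "2 * B * (2 * real R + 1) powr (\<beta> - 1) \<le> \<delta>"
  shows "enn2real (frac_max \<beta> f n) \<le> enn2real (frac_max \<beta> f n') + \<delta>"
proof (rule enn2real_frac_max_le)
  fix r :: nat
  have "0 \<le> B"
    using B[of 0] by linarith
  then have "0 \<le> 2 * B * (2 * real R + 1) powr (\<beta> - 1)"
    by simp
  with small have "0 \<le> \<delta>"
    by linarith
  show "frac_avg \<beta> f n r \<le> enn2real (frac_max \<beta> f n') + \<delta>"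
  proof (cases "r \<le> R")
    case True
    have "frac_avg \<beta> f n r \<le> B * (2 * real r + 1) powr \<beta>"
      by (rule frac_avg_le_bound[OF B])
    also have "\<dots> \<le> B * (2 * real R + 1) powr \<beta>"
      using True assms(1) \<open>0 \<le> B\<close> by (intro mult_left_mono powr_mono2) auto
    finally show ?thesis
      using large \<open>0 \<le> \<delta>\<close> by linarith
  next
    case False
    have "(2 * real r + 1) powr (\<beta> - 1) \<le> (2 * real R + 1) powr (\<beta> - 1)"
      using False assms(2) by (intro powr_mono2') auto
    then have "2 * B * (2 * real r + 1) powr (\<beta> - 1) \<le> 2 * B * (2 * real R + 1) powr (\<beta> - 1)"
      using \<open>0 \<le> B\<close> by (intro mult_left_mono) auto
    moreover have "frac_avg \<beta> f n r
        \<le> frac_avg \<beta> f n' (Suc r) + 2 * B * (2 * real r + 1) powr (\<beta> - 1)"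
      by (rule frac_avg_shift_le) (rule assms)+
    ultimately show ?thesis
      using frac_avg_le_enn2real_frac_max[OF fin, of "Suc r"] small
      by linarith
  qed
qed

section \<open>Variation and q-variation\<close>

text \<open>The sum starts at \<open>a - 1\<close> because the increment there leads into the
  interval.\<close>

lemma Var_of_support:
  assumes "\<And>m. m \<notin> {a..b} \<Longrightarrow> g m = 0"
  shows "Var g = (\<Sum>n=a - 1..b. ennreal \<bar>g (n + 1) - g n\<bar>)"
proof -
  have "Var g = (\<Sum>\<^sub>\<infinity>n\<in>{a - 1..b}. ennreal \<bar>g (n + 1) - g n\<bar>)"
    unfolding Var_def by (rule infsum_cong_neutral) (auto simp: assms)
  then show ?thesis
    by simp
qed

lemma BV_of_support:
  assumes "\<And>m. m \<notin> {a..b} \<Longrightarrow> g m = 0"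
  shows "g \<in> BV"
proof -
  have "Var g = (\<Sum>n=a - 1..b. ennreal \<bar>g (n + 1) - g n\<bar>)"
    by (rule Var_of_support) (rule assms)
  then show ?thesis
    by (simp add: BV_def)
qed

lemma BV_norm_interval:
  fixes a b :: int
  assumes "a \<le> b" "0 \<le> c"
  shows "BV_norm (\<lambda>n. if n \<in> {a..b} then c else 0) = ennreal (2 * c)"
proof -
  let ?g = "\<lambda>n. if n \<in> {a..b} then c else 0"
  have "eventually (\<lambda>n. ?g n = 0) at_bot"
    using eventually_le_at_bot[of "a - 1"] by eventually_elim auto
  then have "(?g \<longlongrightarrow> 0) at_bot"
    by (rule tendsto_eventually)
  then have L: "Lim at_bot ?g = 0"
    by (intro tendsto_Lim) auto
  have "Var ?g = (\<Sum>n=a - 1..b. ennreal \<bar>?g (n + 1) - ?g n\<bar>)"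
    by (rule Var_of_support[of a b]) auto
  \<comment> \<open>Only the jump up at \<open>a - 1\<close> and the jump down at \<open>b\<close>
    remain.\<close>
  also have "\<dots> = (\<Sum>n\<in>{a - 1, b}. ennreal \<bar>?g (n + 1) - ?g n\<bar>)"
    using assms by (intro sum.mono_neutral_right) auto
  also have "\<dots> = ennreal (2 * c)"
    using assms by (simp flip: ennreal_plus)
  finally show ?thesis
    by (simp only: BV_norm_def L) simp
qed

text \<open>A single increment bounds the whole sum of powers from below, so one persistent jump
  will suffice for the theorem.\<close>

lemma Var_q_ge:
  assumes "0 < q" and "0 \<le> c" and "c \<le> \<bar>g (n + 1) - g n\<bar>"
  shows "ennreal c \<le> Var_q q g"
proof -
  define S where "S = (\<Sum>\<^sub>\<infinity>n. ennreal (\<bar>g (n + 1) - g n\<bar> powr q))"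
  have "(\<Sum>\<^sub>\<infinity>n\<in>{n}. ennreal (\<bar>g (n + 1) - g n\<bar> powr q)) \<le> S"
    unfolding S_def by (rule infsum_mono_neutral) (auto intro: nonneg_summable_on_complete)
  then have "ennreal (\<bar>g (n + 1) - g n\<bar> powr q) \<le> S"
    by simp
  moreover have "c powr q \<le> \<bar>g (n + 1) - g n\<bar> powr q"
    using assms by (intro powr_mono2) auto
  ultimately have le: "ennreal (c powr q) \<le> S"
    by (meson ennreal_leI order_trans)
  have "c \<le> enn2real S powr (1 / q)" if "S \<noteq> \<infinity>"
  proof -
    have "enn2real (ennreal (c powr q)) \<le> enn2real S"
      using le that by (intro enn2real_mono) (auto simp: top.not_eq_extremum)
    then have "(c powr q) powr (1 / q) \<le> enn2real S powr (1 / q)"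
      using assms by (intro powr_mono2) auto
    then show ?thesis
      using assms by (simp add: powr_powr)
  qed
  then show ?thesis
    by (auto simp: Var_q_def Let_def S_def[symmetric] intro: ennreal_leI)
qed

section \<open>The spike and the spike on a plateau\<close>

text \<open>At 0, radius 0 gives 1. At 1, the window of radius 0 misses the spike, and among the
  others radius 1 gives the largest average.\<close>

lemma enn2real_frac_max_delta:
  assumes "\<beta> < 1"
  defines "f \<equiv> \<lambda>n::int. if n = 0 then 1 else (0::real)"
  shows "1 \<le> enn2real (frac_max \<beta> f 0)"
    and "enn2real (frac_max \<beta> f 1) \<le> 3 powr (\<beta> - 1)"
proof -
  have "frac_max \<beta> f 0 < \<infinity>"
    by (rule frac_max_finite_of_support[OF assms(1), of 0 0]) (auto simp: f_def)
  from frac_avg_le_enn2real_frac_max[OF this, of 0]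
  show "1 \<le> enn2real (frac_max \<beta> f 0)"
    by (simp add: frac_avg_def f_def)
  show "enn2real (frac_max \<beta> f 1) \<le> 3 powr (\<beta> - 1)"
  proof (rule enn2real_frac_max_le)
    fix r :: nat
    have abs_f: "(\<lambda>m. \<bar>f m\<bar>) = (\<lambda>m. if m = 0 then 1 else 0)"
      by (auto simp: f_def)
    have avg: "frac_avg \<beta> f 1 r = (if r = 0 then 0 else (2 * real r + 1) powr (\<beta> - 1))"
      unfolding frac_avg_eq abs_f using powr_minus_divide[of "2 * real r + 1" "1 - \<beta>"]
      by (auto simp: sum.delta)
    show "frac_avg \<beta> f 1 r \<le> 3 powr (\<beta> - 1)"
      unfolding avg using assms(1) by (auto intro!: powr_mono2')
  qed
qed

lemma exists_large_powr:
  fixes a C :: real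
  assumes "0 < a"
  shows "\<exists>n::nat. C \<le> (2 * real n + 1) powr a"
proof -
  have "filterlim (\<lambda>n::nat. (2 * real n + 1) powr a) at_top sequentially"
    using assms by real_asymp
  then have "eventually (\<lambda>n::nat. C \<le> (2 * real n + 1) powr a) sequentially"
    by (simp add: filterlim_at_top)
  then show ?thesis
    by (auto dest: eventually_happens)
qed

lemma exists_small_powr:
  fixes a \<epsilon> :: real
  assumes "a < 0" "0 < \<epsilon>"
  shows "\<exists>n::nat. (2 * real n + 1) powr a \<le> \<epsilon>"
proof -
  obtain n :: nat where n: "1 / \<epsilon> \<le> (2 * real n + 1) powr (- a)"
    using exists_large_powr[of "- a" "1 / \<epsilon>"] assms by auto
  have "1 / (2 * real n + 1) powr (- a) \<le> 1 / (1 / \<epsilon>)"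
    using n assms by (intro divide_left_mono) auto
  then have "(2 * real n + 1) powr a \<le> \<epsilon>"
    by (simp add: powr_minus_divide)
  then show ?thesis ..
qed

definition spike_plateau :: "real \<Rightarrow> nat \<Rightarrow> int \<Rightarrow> real" where
  "spike_plateau \<epsilon> L n =
     (if n = 0 then 1 else 0) + (if n \<in> {- int L..int L} then \<epsilon> else 0)"

lemma exists_flat_spike_plateau:
  assumes "0 < \<beta>" "\<beta> < 1" "0 < \<epsilon>" "\<epsilon> \<le> 1" "0 < \<delta>"
  shows "\<exists>L. \<bar>enn2real (frac_max \<beta> (spike_plateau \<epsilon> L) 1) -
              enn2real (frac_max \<beta> (spike_plateau \<epsilon> L) 0)\<bar> \<le> \<delta>"
proof -
  \<comment> \<open>The 4 is \<open>2 * B\<close> in \<open>frac_max_shift_le\<close> for the bound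
    \<open>B = 2\<close>.\<close>
  obtain R :: nat where R: "(2 * real R + 1) powr (\<beta> - 1) \<le> \<delta> / 4"
    using exists_small_powr[of "\<beta> - 1" "\<delta> / 4"] assms by auto
  \<comment> \<open>Windows of length \<open>2 * l + 1\<close> in the plateau then outweigh the
    bound on all averages of radius at most \<open>R\<close>.\<close>
  obtain l :: nat where l: "2 * (2 * real R + 1) powr \<beta> / \<epsilon> \<le> (2 * real l + 1) powr \<beta>"
    using exists_large_powr[OF assms(1)] by blast
  \<comment> \<open>With \<open>Suc l\<close> the windows of radius \<open>l\<close> around both 0
    and 1 fit into the plateau.\<close>
  define F where "F = spike_plateau \<epsilon> (Suc l)"
  have bound: "\<bar>F m\<bar> \<le> 2" for m
    using assms by (auto simp: F_def spike_plateau_def)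
  have fin: "frac_max \<beta> F n < \<infinity>" for n
    by (rule frac_max_finite_of_support[OF assms(2), of "- int (Suc l)" "int (Suc l)"])
      (auto simp: F_def spike_plateau_def)
  have large: "2 * (2 * real R + 1) powr \<beta> \<le> enn2real (frac_max \<beta> F n)" if "n \<in> {0, 1}" for n
  proof -
    have "2 * (2 * real R + 1) powr \<beta> \<le> \<epsilon> * (2 * real l + 1) powr \<beta>"
      using l assms(3) by (simp add: field_simps)
    also have "\<dots> \<le> frac_avg \<beta> F n l"
      using that assms(3) by (intro frac_avg_ge_of_const_le) (auto simp: F_def spike_plateau_def)
    also have "\<dots> \<le> enn2real (frac_max \<beta> F n)"
      by (rule frac_avg_le_enn2real_frac_max[OF fin])
    finally show ?thesis .
  qed
  have step: "enn2real (frac_max \<beta> F n) \<le> enn2real (frac_max \<beta> F n') + \<delta>"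
    if "n' \<in> {0, 1}" "\<bar>n - n'\<bar> \<le> 1" for n n'
    by (rule frac_max_shift_le[where B=2 and R=R]) (use assms R bound fin large that in auto)
  have "\<bar>enn2real (frac_max \<beta> F 1) - enn2real (frac_max \<beta> F 0)\<bar> \<le> \<delta>"
    using step[of 0 1] step[of 1 0] by (simp add: abs_le_iff)
  then show ?thesis
    unfolding F_def ..
qed

theorem theorem6:
  fixes \<beta> q :: real
  assumes "0 < \<beta>" and "\<beta> < 1" and "q = 1 / (1 - \<beta>)"
  shows "\<exists>(F :: nat \<Rightarrow> int \<Rightarrow> real) (f :: int \<Rightarrow> real).
           (\<forall>j\<ge>1. F j \<in> BV) \<and> f \<in> BV \<and>
           (\<lambda>j. BV_norm (\<lambda>n. F j n - f n)) \<longlonglongrightarrow> 0 \<and>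
           (\<forall>j\<ge>1. \<forall>n. frac_max \<beta> (F j) n < \<infinity>) \<and> (\<forall>n. frac_max \<beta> f n < \<infinity>) \<and>
           \<not> (\<lambda>j. Var_q q (\<lambda>n. enn2real (frac_max \<beta> (F j) n) - enn2real (frac_max \<beta> f n)))
               \<longlonglongrightarrow> 0"
proof -
  \<comment> \<open>Half of the guaranteed drop for the spike: flatness of the other maximal
    function may use up one half, the other half survives.\<close>
  define \<delta> where "\<delta> = (1 - 3 powr (\<beta> - 1)) / 2"
  have "3 powr (\<beta> - 1) < (3::real) powr 0"
    using assms(2) by (intro powr_less_mono) auto
  then have \<delta>: "0 < \<delta>"
    by (simp add: \<delta>_def)
  define f where "f = (\<lambda>n::int. if n = 0 then 1 else (0::real))"
  \<comment> \<open>The guard \<open>1 \<le> j\<close> keeps the plateau height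
    \<open>1 / real j\<close> positive, as \<open>1 / real 0\<close> is 0.\<close>
  have "\<forall>j. \<exists>L. 1 \<le> j \<longrightarrow>
      \<bar>enn2real (frac_max \<beta> (spike_plateau (1 / real j) L) 1) -
       enn2real (frac_max \<beta> (spike_plateau (1 / real j) L) 0)\<bar> \<le> \<delta>"
    using exists_flat_spike_plateau[OF assms(1,2) _ _ \<delta>] by simp
  then obtain L :: "nat \<Rightarrow> nat" where L: "\<forall>j. 1 \<le> j \<longrightarrow>
      \<bar>enn2real (frac_max \<beta> (spike_plateau (1 / real j) (L j)) 1) -
       enn2real (frac_max \<beta> (spike_plateau (1 / real j) (L j)) 0)\<bar> \<le> \<delta>"
    by (rule choice[THEN exE])
  define F where "F = (\<lambda>j. spike_plateau (1 / real j) (L j))"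
  have flat: "\<bar>enn2real (frac_max \<beta> (F j) 1) - enn2real (frac_max \<beta> (F j) 0)\<bar> \<le> \<delta>" if "1 \<le> j" for j
    using L that by (simp add: F_def)
  have supp_f: "f m = 0" if "m \<notin> {0..0}" for m
    using that by (auto simp: f_def)
  have supp_F: "F j m = 0" if "m \<notin> {- int (L j)..int (L j)}" for j m
    using that by (auto simp: F_def spike_plateau_def)
  \<comment> \<open>The spikes cancel, leaving only the plateau, whose length does not affect the
    norm.\<close>
  have "BV_norm (\<lambda>n. F j n - f n) = ennreal (2 * (1 / real j))" for j
    unfolding F_def f_def spike_plateau_def add_diff_cancel_left'
    by (rule BV_norm_interval) simp_all
  moreover have "(\<lambda>j. ennreal (2 * (1 / real j))) \<longlonglongrightarrow> ennreal (2 * 0)"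
    by (intro tendsto_ennrealI tendsto_mult tendsto_const lim_1_over_n)
  ultimately have lim: "(\<lambda>j. BV_norm (\<lambda>n. F j n - f n)) \<longlonglongrightarrow> 0"
    by simp
  have ge: "ennreal \<delta> \<le> Var_q q (\<lambda>n. enn2real (frac_max \<beta> (F j) n) - enn2real (frac_max \<beta> f n))"
    if "1 \<le> j" for j
  proof (rule Var_q_ge[where n=0])
    show "0 < q" "0 \<le> \<delta>"
      using assms \<delta> by auto
    have "2 * \<delta> \<le> enn2real (frac_max \<beta> f 0) - enn2real (frac_max \<beta> f 1)"
      using enn2real_frac_max_delta[OF assms(2)] by (simp add: f_def \<delta>_def)
    \<comment> \<open>A drop of at least \<open>2 * \<delta>\<close> for \<open>f\<close> meets a
      change of at most \<open>\<delta>\<close> for \<open>F j\<close>.\<close>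
    then show "\<delta> \<le> \<bar>enn2real (frac_max \<beta> (F j) (0 + 1)) - enn2real (frac_max \<beta> f (0 + 1)) -
        (enn2real (frac_max \<beta> (F j) 0) - enn2real (frac_max \<beta> f 0))\<bar>"
      using flat[OF that] by simp
  qed
  have "\<not> (\<lambda>j. Var_q q (\<lambda>n. enn2real (frac_max \<beta> (F j) n) - enn2real (frac_max \<beta> f n))) \<longlonglongrightarrow> 0"
  proof
    assume "(\<lambda>j. Var_q q (\<lambda>n. enn2real (frac_max \<beta> (F j) n) - enn2real (frac_max \<beta> f n))) \<longlonglongrightarrow> 0"
    then have "ennreal \<delta> \<le> 0"
      by (rule Lim_bounded2[where N=1]) (use ge in auto)
    with \<delta> show False
      by simp
  qed
  moreover have "\<forall>j\<ge>1. F j \<in> BV"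
    by (intro allI impI BV_of_support[OF supp_F])
  moreover have "f \<in> BV"
    by (rule BV_of_support[OF supp_f])
  moreover have "\<forall>j\<ge>1. \<forall>n. frac_max \<beta> (F j) n < \<infinity>"
    by (intro allI impI frac_max_finite_of_support[OF assms(2) supp_F])
  moreover have "\<forall>n. frac_max \<beta> f n < \<infinity>"
    by (intro allI frac_max_finite_of_support[OF assms(2) supp_f])
  ultimately show ?thesis
    using lim by blast
qed

end
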